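(* For all integers $n\ge 1$, \[ b(2n,n-1)=p(2n,n-1)=\frac12\sum_{\substack{k\ge1\\ k\text{ odd}}}\binom{2n}{k}EC\left(\frac{k-1}{2}\right)EC\left(\frac{2n-k-1}{2}\right), \] where the sum is over odd $k$ with $1\le k\le 2n-1$.
   Context: For a permutation $\pi=\pi_1\cdots\pi_m\in S_m$, a position $i\in\{1,\dots,m-1\}$ is an ascent if $\pi_i<\pi_{i+1}$ and a descent if $\pi_i>\pi_{i+1}$. The permutation $\pi$ is called ballot if for every $1\le k\le m-1$, the number of ascents among positions $1,\dots,k$ is at least the number of descents among positions $1,\dots,k$. Let $b(m,d)$ be the number of ballot permutations in $S_m$ with exactly $d$ descents. For a cycle $\mathfrak c=(c_1,\dots,c_k)$ of a permutation (fixed points are cycles of length 1), let $\mathrm{cA}(\mathfrak c)$ be the number of $i\in\{1,\dots,k\}$ with $c_i\le c_{i+1}$ and $\mathrm{cD}(\mathfrak c)$ the number with $c_i>c_{i+1}$, where $c_{k+1}=c_1$; let $M(\mathfrak c)=\min(\mathrm{cA}(\mathfrak c),\mathrm{cD}(\mathfrak c))$, and for a permutation $\pi$ let $M(\pi)$ be the sum of $M$ over its cycles. Let $p(m,d)$ be the number of permutations in $S_m$ all of whose cycles have odd length and with $M(\pi)=d$. $E(m,d)$ is the number of permutations of $[m]$ with exactly $d$ descents. The Eulerian–Catalan numbers are $EC(n)=2E(2n,n-1)$ for $n\ge1$, and $EC(0)=1$. *)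

theory Defs
  imports Complex_Main "HOL-Combinatorics.Permutations" "HOL-Combinatorics.Orbits"
begin

text \<open>A permutation of \<open>{1..m}\<close> is a function \<open>\<pi>\<close> with \<open>\<pi> permutes {1..m}\<close>; its one-line
  notation is \<open>\<pi> 1, \<dots>, \<pi> m\<close>, and \<open>\<pi>\<close> is the identity outside \<open>{1..m}\<close>.\<close>

definition ascents_upto :: "(nat \<Rightarrow> nat) \<Rightarrow> nat \<Rightarrow> nat" where
  "ascents_upto \<pi> k = card {i \<in> {1..k}. \<pi> i < \<pi> (i + 1)}"

definition descents_upto :: "(nat \<Rightarrow> nat) \<Rightarrow> nat \<Rightarrow> nat" where
  "descents_upto \<pi> k = card {i \<in> {1..k}. \<pi> i > \<pi> (i + 1)}"

definition des :: "nat \<Rightarrow> (nat \<Rightarrow> nat) \<Rightarrow> nat" where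
  "des m \<pi> = descents_upto \<pi> (m - 1)"

definition ballot :: "nat \<Rightarrow> (nat \<Rightarrow> nat) \<Rightarrow> bool" where
  "ballot m \<pi> \<longleftrightarrow> (\<forall>k \<in> {1..m - 1}. ascents_upto \<pi> k \<ge> descents_upto \<pi> k)"

definition ballot_num :: "nat \<Rightarrow> nat \<Rightarrow> nat" where
  "ballot_num m d = card {\<pi>. \<pi> permutes {1..m} \<and> ballot m \<pi> \<and> des m \<pi> = d}"

definition eulerian :: "nat \<Rightarrow> nat \<Rightarrow> nat" where
  "eulerian m d = card {\<pi>. \<pi> permutes {1..m} \<and> des m \<pi> = d}"

definition EC :: "nat \<Rightarrow> nat" where
  "EC n = (if n = 0 then 1 else 2 * eulerian (2 * n) (n - 1))"

text \<open>A cycle \<open>(c\<^sub>1, \<dots>, c\<^sub>k)\<close> of \<open>\<pi>\<close>, with \<open>c\<^sub>i\<^sub>+\<^sub>1 = \<pi> c\<^sub>i\<close>, is represented by its set of entries;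
  fixed points in \<open>{1..m}\<close> give singleton cycles.\<close>

definition cycles_of :: "nat \<Rightarrow> (nat \<Rightarrow> nat) \<Rightarrow> nat set set" where
  "cycles_of m \<pi> = (\<lambda>x. orbit \<pi> x) ` {1..m}"

definition cA :: "(nat \<Rightarrow> nat) \<Rightarrow> nat set \<Rightarrow> nat" where
  "cA \<pi> C = card {c \<in> C. c \<le> \<pi> c}"

definition cD :: "(nat \<Rightarrow> nat) \<Rightarrow> nat set \<Rightarrow> nat" where
  "cD \<pi> C = card {c \<in> C. c > \<pi> c}"

text \<open>Agreement with the counts over the cyclic word \<open>cs\<close>, indexed from 0.\<close>

lemma card_cycle_positions:
  assumes "distinct cs" and "\<And>i. i < length cs \<Longrightarrow> \<pi> (cs ! i) = cs ! ((i + 1) mod length cs)"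
  shows "card {c \<in> set cs. P c (\<pi> c)}
       = card {i. i < length cs \<and> P (cs ! i) (cs ! ((i + 1) mod length cs))}"
proof -
  have "{c \<in> set cs. P c (\<pi> c)}
      = (!) cs ` {i. i < length cs \<and> P (cs ! i) (cs ! ((i + 1) mod length cs))}"
    using assms(2) by (auto simp: in_set_conv_nth)
  moreover have "inj_on ((!) cs) {i. i < length cs \<and> P (cs ! i) (cs ! ((i + 1) mod length cs))}"
    using assms(1) by (auto simp: inj_on_def nth_eq_iff_index_eq)
  ultimately show ?thesis by (simp add: card_image)
qed

lemma cA_cD_cycle_word:
  assumes "distinct cs" and "\<And>i. i < length cs \<Longrightarrow> \<pi> (cs ! i) = cs ! ((i + 1) mod length cs)"
  shows "cA \<pi> (set cs) = card {i. i < length cs \<and> cs ! i \<le> cs ! ((i + 1) mod length cs)}"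
    and "cD \<pi> (set cs) = card {i. i < length cs \<and> cs ! i > cs ! ((i + 1) mod length cs)}"
  unfolding cA_def cD_def
  using card_cycle_positions[OF assms, of "\<lambda>x y. x \<le> y"]
    card_cycle_positions[OF assms, of "\<lambda>x y. x > y"] by auto

definition M_cycle :: "(nat \<Rightarrow> nat) \<Rightarrow> nat set \<Rightarrow> nat" where
  "M_cycle \<pi> C = min (cA \<pi> C) (cD \<pi> C)"

definition M_perm :: "nat \<Rightarrow> (nat \<Rightarrow> nat) \<Rightarrow> nat" where
  "M_perm m \<pi> = (\<Sum>C \<in> cycles_of m \<pi>. M_cycle \<pi> C)"

definition oddcyc_num :: "nat \<Rightarrow> nat \<Rightarrow> nat" where
  "oddcyc_num m d = card {\<pi>. \<pi> permutes {1..m} \<and> (\<forall>C \<in> cycles_of m \<pi>. odd (card C)) \<and> M_perm m \<pi> = d}"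

end

theory Submission
  imports Defs "HOL-Combinatorics.Cycles" "HOL-Combinatorics.Multiset_Permutations"
    "HOL-Library.Infinite_Set"
begin

text \<open>
  Read a word as a path with an up step at each ascent and a down step at each descent, and call it
  a Dyck word if this path is a Dyck path; its length is then odd.

  By the cycle lemma, each cyclic word of odd length whose numbers of cyclic ascents and
  descents differ by one has exactly one Dyck rotation. Cutting it instead at its maximum leaves a
  word on \<open>2 * j\<close> letters with \<open>j - 1\<close> or \<open>j\<close> descents. Hence a set of size \<open>2 * j + 1\<close> carries
  \<open>EC j\<close> Dyck words and as many such cyclic words.

  If all cycles of a permutation of \<open>2 * n\<close> letters are odd, each cycle \<open>C\<close> satisfies
  \<open>2 * M C + 1 \<le> card C\<close>, so \<open>M = n - 1\<close> forces exactly two cycles, both of the above kind. Twice the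
  number of these permutations is thus the number of ordered pairs of such cyclic words.

  A ballot permutation with \<open>n - 1\<close> descents splits uniquely at the last visit of its path to
  height 0 as \<open>u @ v\<close> with Dyck words \<open>u\<close>, \<open>v\<close> and \<open>last u < hd v\<close>. The involution
  \<open>(u, v) \<mapsto> (rev v, rev u)\<close> on pairs of Dyck words reverses this inequality, so exactly half of
  all pairs arise.
\<close>

section \<open>The cycle lemma\<close>

text \<open>If \<open>\<sigma> = 1\<close>, the start comes right after the last minimum in
  \<open>{..<k}\<close>, up to a shift by \<open>k\<close>; if \<open>\<sigma> = -1\<close>, it is
  the first minimum there. The return to \<open>P i\<close> is asked at offset \<open>k - 1\<close>,
  before the step that closes the period.\<close>

lemma cycle_lemma:
  fixes P :: "nat \<Rightarrow> int"
  assumes k: "0 < k"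
    and step: "\<And>t. \<bar>P (Suc t) - P t\<bar> = 1"
    and per: "\<And>t. P (t + k) = P t + \<sigma>"
    and \<sigma>: "\<bar>\<sigma>\<bar> = 1"
  shows "\<exists>!i. i < k \<and> (\<forall>t<k. P i \<le> P (i + t)) \<and> P (i + (k - 1)) = P i"
proof -
  define G where "G i \<longleftrightarrow> (\<forall>t<k. P i \<le> P (i + t)) \<and> P (i + (k - 1)) = P i" for i
  have G_ge: "P i \<le> P s" if "G i" "i \<le> s" "s < i + k" for i s
    using that unfolding G_def by (metis add_diff_inverse_nat add_less_cancel_left linorder_not_less)
  have G_last: "P (i + k - 1) = P i" if "G i" for i
    using that k unfolding G_def by simp
  \<comment> \<open>Two good starts in one period bound each other both ways. For
    \<open>\<sigma> = 1\<close>, \<open>P i \<le> P (j - 1) = P j - 1\<close> although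
    \<open>P j \<le> P (i + k - 1) = P i\<close>; for \<open>\<sigma> = -1\<close>,
    \<open>P i \<le> P j \<le> P (i + k) = P i - 1\<close>.\<close>
  have no_two: False if "G i" "G j" "i < j" "j < i + k" for i j
  proof (cases "\<sigma> = 1")
    case True
    have "P (j - 1 + k) = P (j - 1) + 1" using per True by simp
    moreover have "j - 1 + k = j + k - 1" using that by simp
    ultimately have "P (j - 1) + 1 = P j" using G_last[OF that(2)] by simp
    moreover have "P i \<le> P (j - 1)" using that by (intro G_ge) auto
    moreover have "P j \<le> P (i + k - 1)" using that by (intro G_ge[OF that(2)]) auto
    ultimately show False using G_last[OF that(1)] by simp
  next
    case False
    then have "\<sigma> = -1" using \<sigma> by auto
    moreover have "P j \<le> P (i + k)" using that by (intro G_ge[OF that(2)]) auto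
    moreover have "P i \<le> P j" using that by (intro G_ge[OF that(1)]) auto
    ultimately show False using per[of i] by simp
  qed
  have G_shift: "G (i + k) \<longleftrightarrow> G i" for i
  proof -
    have "P (i + k + t) = P (i + t) + \<sigma>" for t using per[of "i + t"] by (simp add: ac_simps)
    then show ?thesis unfolding G_def by (simp add: per)
  qed
  define m where "m = Min (P ` {..<k})"
  have m_in: "m \<in> P ` {..<k}" unfolding m_def using k by (intro Min_in) auto
  have m_le: "m \<le> P t" if "t < k" for t unfolding m_def using that by (intro Min_le) auto
  \<comment> \<open>For \<open>\<sigma> = 1\<close> the start is \<open>Suc i\<close>, which may
    equal \<open>k\<close>; \<open>G_shift\<close> then replaces it by \<open>0\<close>.\<close>
  have "\<exists>i. i \<le> k \<and> G i"
  proof (cases "\<sigma> = 1")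
    case True
    define i where "i = Max {i. i < k \<and> P i = m}"
    have "i \<in> {i. i < k \<and> P i = m}" unfolding i_def using m_in by (intro Max_in) auto
    then have i: "i < k" "P i = m" by auto
    \<comment> \<open>After the last minimum, values inside the first period exceed
      \<open>m\<close>, and later ones are earlier values plus one. The bound reaches
      \<open>i + k\<close>, the last index that \<open>G (Suc i)\<close> inspects.\<close>
    have above: "m < P s" if "i < s" "s < i + k + 1" for s
    proof (cases "s < k")
      case True
      have "P s \<noteq> m"
      proof
        assume "P s = m"
        then have "s \<le> i" unfolding i_def using True by (intro Max_ge) auto
        with that show False by simp
      qed
      with m_le[OF True] show ?thesis by simp
    next
      case False
      then have "P s = P (s - k) + 1" using per[of "s - k"] \<open>\<sigma> = 1\<close> by simp
      moreover have "m \<le> P (s - k)" using False that i by (intro m_le) auto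
      ultimately show ?thesis by simp
    qed
    have "P (Suc i) = m + 1" using above[of "Suc i"] step[of i] i k by auto
    moreover have "m + 1 \<le> P (Suc i + t)" if "t < k" for t
      using above[of "Suc i + t"] that by simp
    moreover have "P (Suc i + (k - 1)) = m + 1"
      using per[of i] i k \<open>\<sigma> = 1\<close> by simp
    ultimately have "G (Suc i)" unfolding G_def by simp
    then show ?thesis using i by (intro exI[of _ "Suc i"]) auto
  next
    case False
    then have \<sigma>: "\<sigma> = -1" using \<sigma> by auto
    define i where "i = (LEAST i. i < k \<and> P i = m)"
    have i: "i < k \<and> P i = m" unfolding i_def by (rule LeastI_ex) (use m_in in auto)
    have before: "m < P s" if "s < i" for s
    proof -
      have "\<not> (s < k \<and> P s = m)" using that unfolding i_def by (rule not_less_Least)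
      then show ?thesis using that i m_le[of s] by auto
    qed
    have ge: "m \<le> P s" if "i \<le> s" "s < i + k" for s
    proof (cases "s < k")
      case False
      then have "P s = P (s - k) - 1" using per[of "s - k"] \<sigma> by simp
      moreover have "m < P (s - k)" using False that by (intro before) auto
      ultimately show ?thesis by simp
    qed (rule m_le)
    have "P (i + k) = m - 1" using per[of i] i \<sigma> by simp
    moreover have "Suc (i + (k - 1)) = i + k" using k by simp
    \<comment> \<open>The path is still at least \<open>m\<close> here and stands at
      \<open>m - 1\<close> one unit step later.\<close>
    ultimately have "P (i + (k - 1)) = m"
      using step[of "i + (k - 1)"] ge[of "i + (k - 1)"] k by simp linarith
    then have "G i" unfolding G_def using ge i by auto
    then show ?thesis using i by (intro exI[of _ i]) auto
  qed
  then obtain i where "i \<le> k" "G i" by blast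
  then have ex: "\<exists>i<k. G i" using G_shift[of 0] k by (cases "i = k") (auto simp: le_less)
  moreover have "i = j" if "i < k" "G i" "j < k" "G j" for i j
    using no_two[of i j] no_two[of j i] that by (cases i j rule: linorder_cases) auto
  ultimately have "\<exists>!i. i < k \<and> G i" by blast
  then show ?thesis unfolding G_def .
qed

section \<open>Heights of cyclic words and Dyck words\<close>

definition step :: "nat \<Rightarrow> nat \<Rightarrow> int" where
  "step x y = (if x \<le> y then 1 else - 1)"

text \<open>
  Indices are cyclic: \<open>height w (length w)\<close> includes the closing step from the last letter to the
  first, which is an up step for a one-letter word, in accordance with \<^const>\<open>cA\<close>.
\<close>

definition height :: "nat list \<Rightarrow> nat \<Rightarrow> int" where
  "height w t = (\<Sum>s<t. step (w ! (s mod length w)) (w ! (Suc s mod length w)))"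

text \<open>Heights below \<open>length w\<close> see only steps between neighbouring letters, so
  this is the linear notion. One-letter words are Dyck.\<close>

definition dyck :: "nat list \<Rightarrow> bool" where
  "dyck w \<longleftrightarrow> w \<noteq> [] \<and> (\<forall>t<length w. 0 \<le> height w t) \<and> height w (length w - 1) = 0"

lemma abs_step [simp]: "\<bar>step x y\<bar> = 1"
  by (simp add: step_def)

lemma odd_step [simp]: "odd (step x y)"
  by (simp add: step_def)

lemma step_swap: "x \<noteq> y \<Longrightarrow> step y x = - step x y"
  by (auto simp: step_def)

lemma height_0 [simp]: "height w 0 = 0"
  by (simp add: height_def)

lemma height_Suc:
  "height w (Suc t) = height w t + step (w ! (t mod length w)) (w ! (Suc t mod length w))"
  by (simp add: height_def)

lemma even_height: "even (height w t) \<longleftrightarrow> even t"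
  by (induction t) (auto simp: height_Suc)

text \<open>Since indices are cyclic, rotating a word only moves the origin of its path.\<close>

lemma height_rotate:
  assumes "w \<noteq> []"
  shows "height (rotate i w) t = height w (i + t) - height w i"
proof (induction t)
  case (Suc t)
  have "rotate i w ! (s mod length w) = w ! ((i + s) mod length w)" for s
    using assms by (simp add: nth_rotate mod_add_right_eq)
  from this[of t] this[of "Suc t"] Suc show ?case by (simp add: height_Suc)
qed simp

lemma height_add_length: "height w (t + length w) = height w t + height w (length w)"
proof (induction t)
  case (Suc t)
  then show ?case
    using height_Suc[of w "t + length w"] by (simp add: height_Suc flip: add_Suc)
qed simp

lemma dyck_rotate_iff:
  assumes "w \<noteq> []"
  shows "dyck (rotate i w) \<longleftrightarrow> (\<forall>t<length w. height w i \<le> height w (i + t)) \<and>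
    height w (i + (length w - 1)) = height w i"
  using assms by (auto simp: dyck_def height_rotate)

lemma odd_length_dyck: "dyck w \<Longrightarrow> odd (length w)"
  using even_height[of w "length w - 1"] by (auto simp: dyck_def)

lemma abs_height_dyck: "dyck w \<Longrightarrow> \<bar>height w (length w)\<bar> = 1"
  using height_Suc[of w "length w - 1"] by (auto simp: dyck_def)

text \<open>The periodically continued path gains \<open>height w (length w)\<close>, that is 1 or
  -1, in each turn, so the cycle lemma applies.\<close>

lemma ex1_dyck_rotate:
  assumes "w \<noteq> []" "\<bar>height w (length w)\<bar> = 1"
  shows "\<exists>!i. i < length w \<and> dyck (rotate i w)"
  unfolding dyck_rotate_iff[OF assms(1)]
  using assms by (intro cycle_lemma[where \<sigma> = "height w (length w)"])
    (auto simp: height_Suc height_add_length)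

section \<open>Cyclic words and cyclic permutations\<close>

definition dyck_words :: "nat set \<Rightarrow> nat list set" where
  "dyck_words A = {w \<in> permutations_of_set A. dyck w}"

text \<open>The closing step is included, which makes the condition invariant under
  rotation.\<close>

definition cyclic_words :: "nat set \<Rightarrow> nat list set" where
  "cyclic_words A = {w \<in> permutations_of_set A. \<bar>height w (length w)\<bar> = 1}"

text \<open>For finite \<open>A\<close> the sum is \<open>cA \<pi> A - cD \<pi> A\<close>; fixed
  points count as ascents in both.\<close>

definition cyclic_perms :: "nat set \<Rightarrow> (nat \<Rightarrow> nat) set" where
  "cyclic_perms A = {\<pi>. \<pi> permutes A \<and> cyclic_on \<pi> A \<and> \<bar>\<Sum>c\<in>A. step c (\<pi> c)\<bar> = 1}"

lemma rotate_in_cyclic_words: "w \<in> cyclic_words A \<Longrightarrow> rotate i w \<in> cyclic_words A"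
  by (cases "w = []")
    (auto simp: cyclic_words_def permutations_of_set_def height_rotate height_add_length)

section \<open>Words and the cycles they denote\<close>

lemma sum_step_eq_height:
  assumes "distinct w" "\<And>i. i < length w \<Longrightarrow> \<pi> (w ! i) = w ! (Suc i mod length w)"
  shows "(\<Sum>c\<in>set w. step c (\<pi> c)) = height w (length w)"
proof -
  have "bij_betw ((!) w) {..<length w} (set w)" using assms(1) by (simp add: bij_betw_nth)
  then have "(\<Sum>c\<in>set w. step c (\<pi> c)) = (\<Sum>i<length w. step (w ! i) (\<pi> (w ! i)))"
    by (intro sum.reindex_bij_betw[symmetric])
  then show ?thesis using assms(2) by (simp add: height_def)
qed

lemma cycle_of_list_nth:
  assumes "distinct w" "i < length w"
  shows "cycle_of_list w (w ! i) = w ! (Suc i mod length w)"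
proof -
  have "map (cycle_of_list w) w = rotate1 w" using cyclic_rotation[OF assms(1), of 1] by simp
  then show ?thesis using assms(2) by (metis nth_map nth_rotate1)
qed

lemma funpow_cycle_of_list_nth:
  assumes "distinct w" "i < length w"
  shows "(cycle_of_list w ^^ t) (w ! i) = w ! ((i + t) mod length w)"
proof -
  have "length w > 0" using assms by auto
  then show ?thesis
    by (induction t) (use assms in \<open>auto simp: cycle_of_list_nth mod_Suc_eq\<close>)
qed

lemma cyclic_on_cycle_of_list:
  assumes "distinct w" "w \<noteq> []"
  shows "cyclic_on (cycle_of_list w) (set w)"
proof (rule cyclic_on_singleI[of "w ! 0"])
  have "(cycle_of_list w ^^ length w) (w ! 0) = w ! 0"
    using assms funpow_cycle_of_list_nth[of w 0 "length w"] by simp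
  then have "orbit (cycle_of_list w) (w ! 0) = {(cycle_of_list w ^^ m) (w ! 0) |m. m < length w}"
    using assms by (intro orbit_altdef_bounded) auto
  also have "\<dots> = {w ! m |m. m < length w}"
    using assms funpow_cycle_of_list_nth[of w 0] by (intro Collect_cong ex_cong1) auto
  finally show "set w = orbit (cycle_of_list w) (w ! 0)" by (auto simp: in_set_conv_nth)
qed (use assms in auto)

text \<open>Each word lists the iterates of the common cycle from its own first letter;
  \<open>i\<close> is the position of \<open>v ! 0\<close> in \<open>w\<close>.\<close>

lemma rotation_if_cycle_of_list_eq:
  assumes "distinct w" "distinct v" "set w = set v" "cycle_of_list w = cycle_of_list v" "v \<noteq> []"
  obtains i where "i < length w" "v = rotate i w"
proof -
  have len: "length v = length w" using assms distinct_card by metis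
  have "v ! 0 \<in> set w" using assms by auto
  then obtain i where i: "i < length w" "w ! i = v ! 0" by (auto simp: in_set_conv_nth)
  have "v ! t = rotate i w ! t" if "t < length v" for t
  proof -
    have "v ! t = (cycle_of_list v ^^ t) (v ! 0)"
      using funpow_cycle_of_list_nth[of v 0 t] that assms by auto
    also have "\<dots> = rotate i w ! t"
      using funpow_cycle_of_list_nth[of w i t] that i assms len by (simp add: nth_rotate)
    finally show ?thesis .
  qed
  then have "v = rotate i w" using len by (intro nth_equalityI) auto
  then show thesis using that i by blast
qed

text \<open>The word lists the orbit of some point of \<open>A\<close> up to the first return time
  \<open>k\<close>.\<close>

lemma cyclic_perm_eq_cycle_of_list:
  assumes "\<pi> permutes A" "cyclic_on \<pi> A"
  obtains w where "w \<in> permutations_of_set A" "\<pi> = cycle_of_list w"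
proof -
  obtain x where x: "x \<in> A" "A = orbit \<pi> x" using assms by (auto simp: cyclic_on_def)
  define k where "k = funpow_dist1 \<pi> x x"
  define w where "w = map (\<lambda>i. (\<pi> ^^ i) x) [0..<k]"
  have inj: "inj_on (\<lambda>i. (\<pi> ^^ i) x) {0..<k}"
    unfolding k_def using x by (intro inj_on_funpow_dist1) auto
  have pk: "(\<pi> ^^ k) x = x" unfolding k_def using x by (intro funpow_dist1_prop) auto
  have w: "distinct w" "set w = A" "length w = k"
    using inj orbit_conv_funpow_dist1[of x \<pi>] x
    by (simp_all add: w_def distinct_map flip: k_def)
  have "\<pi> c = cycle_of_list w c" for c
  proof (cases "c \<in> A")
    case True
    then obtain i where i: "i < k" "c = w ! i" using w by (metis in_set_conv_nth)
    have "\<pi> (w ! i) = w ! (Suc i mod k)"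
      using i pk by (cases "Suc i = k") (auto simp: w_def)
    then show ?thesis using i w cycle_of_list_nth[of w i] by simp
  next
    case False
    then show ?thesis using w assms id_outside_supp[of c w] by (simp add: permutes_not_in)
  qed
  then show thesis using that[of w] w by (auto simp: permutations_of_set_def)
qed

text \<open>The predicate \<open>R\<close> picks one representative from each rotation class, and
  these classes correspond to the cyclic permutations. It is applied twice: with
  \<open>dyck\<close>, and with the condition that the maximum comes first.\<close>

lemma card_cyclic_perms:
  assumes "A \<noteq> {}"
    and R: "\<And>w. w \<in> cyclic_words A \<Longrightarrow> \<exists>!i. i < length w \<and> R (rotate i w)"
  shows "card (cyclic_perms A) = card {w \<in> cyclic_words A. R w}"
proof -
  have in_perms: "cycle_of_list w \<in> cyclic_perms A \<longleftrightarrow> w \<in> cyclic_words A"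
    if "w \<in> permutations_of_set A" for w
  proof -
    have "distinct w" "set w = A" "w \<noteq> []" using that assms(1) by (auto simp: permutations_of_set_def)
    moreover from this have "(\<Sum>c\<in>A. step c (cycle_of_list w c)) = height w (length w)"
      using sum_step_eq_height[of w "cycle_of_list w"] by (simp add: cycle_of_list_nth)
    ultimately show ?thesis
      using that cyclic_on_cycle_of_list[of w] cycle_permutes[of w]
      by (simp add: cyclic_perms_def cyclic_words_def)
  qed
  have "bij_betw cycle_of_list {w \<in> cyclic_words A. R w} (cyclic_perms A)"
  proof (rule bij_betw_imageI)
    show "inj_on cycle_of_list {w \<in> cyclic_words A. R w}"
    proof (rule inj_onI, clarify)
      fix w v assume *: "w \<in> cyclic_words A" "v \<in> cyclic_words A" "R w" "R v"
        "cycle_of_list w = cycle_of_list v"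
      have "distinct w" "distinct v" "set w = set v" "v \<noteq> []"
        using * assms(1) by (auto simp: cyclic_words_def permutations_of_set_def)
      then obtain i where i: "i < length w" "v = rotate i w"
        using * rotation_if_cycle_of_list_eq by metis
      \<comment> \<open>Both rotation by \<open>0\<close> and rotation by \<open>i\<close> satisfy
        \<open>R\<close>, so uniqueness identifies them.\<close>
      then have "i = 0" using R[OF *(1)] * by (metis gr_zeroI not_less0 rotate0 id_apply)
      with i show "w = v" by simp
    qed
    show "cycle_of_list ` {w \<in> cyclic_words A. R w} = cyclic_perms A"
    proof (intro equalityI subsetI)
      fix \<pi> assume "\<pi> \<in> cyclic_perms A"
      moreover from this obtain w where w: "w \<in> permutations_of_set A" "\<pi> = cycle_of_list w"
        by (auto simp: cyclic_perms_def elim: cyclic_perm_eq_cycle_of_list)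
      ultimately have "w \<in> cyclic_words A" using in_perms by simp
      moreover obtain i where "R (rotate i w)" using R[OF \<open>w \<in> cyclic_words A\<close>] by blast
      moreover have "cycle_of_list (rotate i w) = cycle_of_list w"
      proof
        fix c
        show "cycle_of_list (rotate i w) c = cycle_of_list w c"
        proof (cases "c \<in> set w")
          case True
          then have "c \<in> set (rotate i w)" by simp
          then obtain t where t: "t < length w" "c = rotate i w ! t"
            by (metis in_set_conv_nth length_rotate)
          then have "w \<noteq> []" by auto
          have dist: "distinct w" using w by (simp add: permutations_of_set_def)
          have "cycle_of_list (rotate i w) c = w ! ((i + Suc t mod length w) mod length w)"
            unfolding t(2) using t(1) dist \<open>w \<noteq> []\<close>
            by (subst cycle_of_list_nth) (simp_all add: nth_rotate)
          also have "\<dots> = w ! (Suc ((i + t) mod length w) mod length w)"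
            by (simp add: mod_simps)
          also have "\<dots> = cycle_of_list w c"
            using t dist \<open>w \<noteq> []\<close> by (simp add: cycle_of_list_nth nth_rotate)
          finally show ?thesis .
        qed (simp add: id_outside_supp)
      qed
      ultimately show "\<pi> \<in> cycle_of_list ` {w \<in> cyclic_words A. R w}"
        using w rotate_in_cyclic_words by (metis (mono_tags, lifting) image_eqI mem_Collect_eq)
    qed (use in_perms in \<open>auto simp: cyclic_words_def\<close>)
  qed
  then show ?thesis by (rule bij_betw_same_card[symmetric])
qed

text \<open>The representatives are the Dyck rotations. Every Dyck word qualifies as a cyclic word,
  because its closing step takes the height from 0 to 1 or -1.\<close>

lemma card_dyck_words:
  assumes "A \<noteq> {}"
  shows "card (dyck_words A) = card (cyclic_perms A)"
proof -
  have "card (cyclic_perms A) = card {w \<in> cyclic_words A. dyck w}"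
    using assms by (intro card_cyclic_perms ex1_dyck_rotate)
      (auto simp: cyclic_words_def permutations_of_set_def)
  also have "{w \<in> cyclic_words A. dyck w} = dyck_words A"
    using abs_height_dyck by (auto simp: cyclic_words_def dyck_words_def)
  finally show ?thesis ..
qed

section \<open>Counting cyclic words\<close>

lemma height_append_left: "t < length u \<Longrightarrow> height (u @ v) t = height u t"
  by (induction t) (auto simp: height_Suc nth_append)

text \<open>In the concatenation, the step from \<open>last u\<close> to \<open>hd v\<close> takes
  the place of the closing step of \<open>u\<close>.\<close>

lemma height_append_right:
  assumes "u \<noteq> []" "t < length v"
  shows "height (u @ v) (length u + t) =
    height u (length u - 1) + step (last u) (hd v) + height v t"
  using assms(2)
proof (induction t)
  case 0
  have "height (u @ v) (Suc (length u - 1)) = height u (length u - 1) + step (last u) (hd v)"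
    unfolding height_Suc using 0 assms(1)
    by (cases v) (auto simp: height_append_left nth_append last_conv_nth)
  then show ?case using assms(1) by simp
next
  case (Suc t)
  then show ?case using height_Suc[of "u @ v" "length u + t"]
    by (auto simp: height_Suc nth_append)
qed

text \<open>The same steps are traversed backwards with opposite signs. Distinctness rules out equal
  neighbours, for which \<open>step\<close> is not antisymmetric.\<close>

lemma height_rev:
  assumes "distinct w" "t < length w"
  shows "height (rev w) t = height w (length w - 1 - t) - height w (length w - 1)"
  using assms(2)
proof (induction t)
  case (Suc t)
  define s where "s = length w - 1 - Suc t"
  have s: "length w - 1 - t = Suc s" "Suc s < length w" using Suc.prems by (auto simp: s_def)
  have "rev w ! t = w ! Suc s" "rev w ! Suc t = w ! s"
    using Suc.prems s by (auto simp: rev_nth s_def)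
  moreover have "w ! s \<noteq> w ! Suc s" using assms(1) s by (simp add: nth_eq_iff_index_eq)
  ultimately have "height (rev w) (Suc t) = height (rev w) t - step (w ! s) (w ! Suc s)"
    using Suc.prems step_swap[of "w ! s" "w ! Suc s"] by (simp add: height_Suc)
  also have "\<dots> = height w s - height w (length w - 1)"
    using Suc s by (simp add: height_Suc)
  finally show ?case by (simp add: s_def)
qed simp

lemma dyck_rev: "distinct w \<Longrightarrow> dyck w \<Longrightarrow> dyck (rev w)"
  by (auto simp: dyck_def height_rev)

text \<open>Heights depend only on the relative order of the letters, so counts on
  \<open>{1..2 * n}\<close> carry over to any set of that size.\<close>

lemma height_map:
  assumes "strict_mono_on A f" "set w \<subseteq> A" "w \<noteq> []"
  shows "height (map f w) t = height w t"
proof -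
  have "step (f x) (f y) = step x y" if "x \<in> A" "y \<in> A" for x y
    using that assms(1) by (simp add: step_def strict_mono_on_less_eq)
  moreover have "w ! (s mod length w) \<in> A" for s using assms(2,3) by (simp add: subsetD)
  ultimately show ?thesis using assms(3) by (simp add: height_def)
qed

section \<open>Permutations as words and Eulerian counts\<close>

lemma word_of_perm_bij:
  "bij_betw (\<lambda>\<pi>. map \<pi> [1..<Suc m]) {\<pi>. \<pi> permutes {1..m}} (permutations_of_set {1..m})"
proof (rule bij_betw_imageI)
  let ?W = "\<lambda>\<pi> :: nat \<Rightarrow> nat. map \<pi> [1..<Suc m]"
  show inj: "inj_on ?W {\<pi>. \<pi> permutes {1..m}}"
  proof (rule inj_onI, clarify)
    fix \<pi> \<rho> assume *: "\<pi> permutes {1..m}" "\<rho> permutes {1..m}" "?W \<pi> = ?W \<rho>"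
    have "\<pi> x = \<rho> x" for x
      using * by (cases "x \<in> {1..m}") (auto simp: permutes_not_in simp del: upt_Suc)
    then show "\<pi> = \<rho>" by blast
  qed
  have "?W ` {\<pi>. \<pi> permutes {1..m}} \<subseteq> permutations_of_set {1..m}"
  proof clarify
    fix \<pi> assume \<pi>: "\<pi> permutes {1..m}"
    have "set [1..<Suc m] = {1..m}" by auto
    then show "?W \<pi> \<in> permutations_of_set {1..m}"
      using \<pi> by (auto simp: permutations_of_set_def distinct_map permutes_image
          simp del: upt_Suc intro: permutes_inj_on)
  qed
  \<comment> \<open>Surjectivity follows by counting: both sets have \<open>fact m\<close>
    elements.\<close>
  then show "?W ` {\<pi>. \<pi> permutes {1..m}} = permutations_of_set {1..m}"
    using inj by (intro card_subset_eq) (simp_all add: card_image card_permutations)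
qed

lemma card_filter_atLeastAtMost_Suc:
  "card {i \<in> {1..Suc k}. Q i} = card {i \<in> {1..k}. Q i} + (if Q (Suc k) then 1 else 0)"
proof -
  have "{i \<in> {1..Suc k}. Q i} =
    (if Q (Suc k) then insert (Suc k) {i \<in> {1..k}. Q i} else {i \<in> {1..k}. Q i})"
    by (auto simp: le_Suc_eq)
  then show ?thesis by simp
qed

text \<open>Neighbours are distinct, so each position is an ascent or a descent. The second conjunct
  allows the counts themselves, not only their difference, to be read off the height.\<close>

lemma ascents_descents_height:
  assumes "\<pi> permutes {1..m}" "k < m"
  shows "int (ascents_upto \<pi> k) - int (descents_upto \<pi> k) = height (map \<pi> [1..<Suc m]) k \<and>
    ascents_upto \<pi> k + descents_upto \<pi> k = k"
  using assms(2)
proof (induction k)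
  case 0
  show ?case by (simp add: ascents_upto_def descents_upto_def)
next
  case (Suc k)
  have neq: "\<pi> (Suc k) \<noteq> \<pi> (Suc (Suc k))"
    using inj_eq[OF permutes_inj[OF assms(1)], of "Suc k" "Suc (Suc k)"] by simp
  have nth: "map \<pi> [1..<Suc m] ! i = \<pi> (Suc i)" if "i < m" for i
    using that by (simp del: upt_Suc)
  have "height (map \<pi> [1..<Suc m]) (Suc k) =
    height (map \<pi> [1..<Suc m]) k + step (\<pi> (Suc k)) (\<pi> (Suc (Suc k)))"
    using Suc.prems nth[of k] nth[of "Suc k"] by (simp add: height_Suc del: upt_Suc)
  moreover have "ascents_upto \<pi> (Suc k) = ascents_upto \<pi> k + (if \<pi> (Suc k) < \<pi> (Suc (Suc k)) then 1 else 0)"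
    "descents_upto \<pi> (Suc k) = descents_upto \<pi> k + (if \<pi> (Suc k) > \<pi> (Suc (Suc k)) then 1 else 0)"
    unfolding ascents_upto_def descents_upto_def card_filter_atLeastAtMost_Suc by simp_all
  ultimately show ?case
    using Suc.IH Suc.prems neq by (simp add: step_def del: upt_Suc)
qed

text \<open>Among \<open>2 * n - 1\<close> positions, \<open>n - 1\<close> descents leave
  \<open>n\<close> ascents.\<close>

lemma des_eq_iff_height:
  assumes "\<pi> permutes {1..2 * n}" "n \<ge> 1"
  shows "des (2 * n) \<pi> = n - 1 \<longleftrightarrow> height (map \<pi> [1..<Suc (2 * n)]) (2 * n - 1) = 1"
proof -
  have "2 * n - 1 < 2 * n" using assms(2) by simp
  from ascents_descents_height[OF assms(1) this] show ?thesis
    unfolding des_def using assms(2) by (intro iffI; linarith)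
qed

lemma card_words_height_1:
  assumes "finite A" "card A = 2 * n" "n \<ge> 1"
  shows "card {w \<in> permutations_of_set A. height w (2 * n - 1) = 1} = eulerian (2 * n) (n - 1)"
proof -
  let ?I = "{1..2 * n}"
  obtain h where h: "bij_betw h {..<card A} A" "strict_mono_on {..<card A} h"
    using assms(1) by (rule ex_bij_betw_strict_mono_card)
  \<comment> \<open>The enumeration \<open>h\<close> of \<open>A\<close> starts at 0, the letters of
    a permutation at 1.\<close>
  define f where "f x = h (x - 1)" for x
  have f_mono: "strict_mono_on ?I f"
  proof (rule strict_mono_onI)
    fix r s assume "r \<in> ?I" "s \<in> ?I" "r < s"
    then have "r - 1 < s - 1" "r - 1 \<in> {..<card A}" "s - 1 \<in> {..<card A}" using assms(2) by auto
    then show "f r < f s" unfolding f_def using strict_mono_onD[OF h(2)] by blast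
  qed
  have "f ` ?I = h ` ((\<lambda>x. x - 1) ` ?I)" by (auto simp: f_def)
  also have "(\<lambda>x. x - 1) ` ?I = {..<card A}"
  proof -
    have "(\<lambda>x. x - 1) ` Suc ` {..<2 * n} = {..<2 * n}" by (simp add: image_image)
    then show ?thesis using assms(2) by (simp only: image_Suc_lessThan)
  qed
  finally have f_im: "f ` ?I = A" using h(1) by (simp add: bij_betw_def)
  have f_inj: "inj_on f ?I" using f_mono by (rule strict_mono_on_imp_inj_on)
  let ?X = "{w \<in> permutations_of_set ?I. height w (2 * n - 1) = 1}"
  have "height (map f w) (2 * n - 1) = height w (2 * n - 1)" if "w \<in> permutations_of_set ?I" for w
    using that assms(3) by (intro height_map[OF f_mono]) (auto simp: permutations_of_set_def)
  then have "{w \<in> permutations_of_set A. height w (2 * n - 1) = 1} = map f ` ?X"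
    unfolding f_im[symmetric] permutations_of_set_image_inj[OF f_inj] by auto
  moreover have "inj_on (map f) ?X"
    by (intro inj_on_mapI inj_on_subset[OF f_inj]) (auto simp: permutations_of_set_def)
  moreover have "bij_betw (\<lambda>\<pi>. map \<pi> [1..<Suc (2 * n)])
     {\<pi> \<in> {\<pi>. \<pi> permutes ?I}. des (2 * n) \<pi> = n - 1} ?X"
    using word_of_perm_bij by (rule bij_betw_Collect) (use des_eq_iff_height assms(3) in simp)
  ultimately show ?thesis by (simp add: eulerian_def card_image bij_betw_same_card)
qed

text \<open>Reversal exchanges final heights 1 and -1; this is the factor 2 in
  \<open>EC\<close>.\<close>

lemma card_words_abs_height_1:
  assumes "finite A" "card A = 2 * n" "n \<ge> 1"
  shows "card {w \<in> permutations_of_set A. \<bar>height w (2 * n - 1)\<bar> = 1} = EC n"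
proof -
  let ?X = "\<lambda>s. {w \<in> permutations_of_set A. height w (2 * n - 1) = s}"
  have len: "length w = 2 * n" "distinct w" if "w \<in> permutations_of_set A" for w
    using that assms(2) by (auto simp: permutations_of_set_def distinct_card)
  have rev_mem: "rev w \<in> ?X (- s)" if "w \<in> ?X s" for w s
    using that len[of w] assms(3) height_rev[of w "2 * n - 1"]
    by (auto simp: permutations_of_set_def)
  have "bij_betw rev (?X 1) (?X (- 1))"
    by (rule bij_betw_byWitness[of _ rev]) (use rev_mem[of _ 1] rev_mem[of _ "- 1"] in auto)
  then have "card (?X (- 1)) = card (?X 1)" by (rule bij_betw_same_card[symmetric])
  moreover have "{w \<in> permutations_of_set A. \<bar>height w (2 * n - 1)\<bar> = 1} = ?X 1 \<union> ?X (- 1)"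
    by auto
  moreover have "card (?X 1 \<union> ?X (- 1)) = card (?X 1) + card (?X (- 1))"
    by (intro card_Un_disjoint) auto
  ultimately show ?thesis
    using card_words_height_1[OF assms] assms(3) by (simp add: EC_def)
qed

text \<open>The down step leaving \<open>M\<close> and the closing up step back to \<open>M\<close>
  cancel.\<close>

lemma height_Cons_greater:
  assumes "v \<noteq> []" "\<And>x. x \<in> set v \<Longrightarrow> x < M"
  shows "height (M # v) (Suc (length v)) = height v (length v - 1)"
proof -
  have "height (M # v) (length v) = step M (hd v) + height v (length v - 1)"
    using height_append_right[of "[M]" "length v - 1" v] assms(1) by simp
  moreover have "step M (hd v) = - 1" using assms(2)[of "hd v"] assms(1) by (simp add: step_def)
  moreover have "step (v ! (length v - 1)) M = 1"
    using assms(2)[of "v ! (length v - 1)"] assms(1) by (simp add: step_def)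
  ultimately show ?thesis using assms(1) by (simp add: height_Suc nth_Cons')
qed

text \<open>Each cyclic word is represented by its rotation starting with the maximum
  \<open>M\<close>. Deleting \<open>M\<close> leaves the height before the closing step unchanged,
  as in \<open>height_Cons_greater\<close>, and any word on \<open>A - {M}\<close> of final height 1
  or -1 can arise.\<close>

lemma card_cyclic_perms_eq_EC:
  assumes "finite A" "odd (card A)"
  shows "card (cyclic_perms A) = EC ((card A - 1) div 2)"
proof -
  define M where "M = Max A"
  have ne: "A \<noteq> {}" using assms(2) by auto
  have M: "M \<in> A" "\<And>x. x \<in> A - {M} \<Longrightarrow> x < M"
    using ne assms(1) by (auto simp: M_def less_le)
  have "card (cyclic_perms A) = card {w \<in> cyclic_words A. hd w = M}"
  proof (rule card_cyclic_perms[OF ne])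
    fix w assume "w \<in> cyclic_words A"
    then have w: "distinct w" "set w = A" "w \<noteq> []"
      using ne by (auto simp: cyclic_words_def permutations_of_set_def)
    then have "hd (rotate i w) = w ! i" if "i < length w" for i
      using that by (simp add: hd_rotate_conv_nth)
    moreover have "\<exists>!i. i < length w \<and> w ! i = M"
      using w M(1) by (metis in_set_conv_nth nth_eq_iff_index_eq)
    ultimately show "\<exists>!i. i < length w \<and> hd (rotate i w) = M" by metis
  qed
  also have "{w \<in> cyclic_words A. hd w = M} =
    (#) M ` {v \<in> permutations_of_set (A - {M}). \<bar>height (M # v) (Suc (length v))\<bar> = 1}"
  proof (intro equalityI subsetI)
    fix w assume w: "w \<in> {w \<in> cyclic_words A. hd w = M}"
    then obtain v where "w = M # v"
      using ne by (cases w) (auto simp: cyclic_words_def permutations_of_set_def)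
    moreover from this w have "v \<in> {v \<in> permutations_of_set (A - {M}).
        \<bar>height (M # v) (Suc (length v))\<bar> = 1}"
      by (auto simp: cyclic_words_def permutations_of_set_def)
    ultimately show "w \<in> (#) M ` {v \<in> permutations_of_set (A - {M}).
        \<bar>height (M # v) (Suc (length v))\<bar> = 1}" by blast
  next
    fix w assume "w \<in> (#) M ` {v \<in> permutations_of_set (A - {M}).
        \<bar>height (M # v) (Suc (length v))\<bar> = 1}"
    then obtain v where v: "w = M # v" "set v = A - {M}" "distinct v"
      "\<bar>height (M # v) (Suc (length v))\<bar> = 1" by (auto simp: permutations_of_set_def)
    from v(2) have "insert M (set v) = A" "M \<notin> set v" using M(1) by blast+
    with v show "w \<in> {w \<in> cyclic_words A. hd w = M}"
      by (simp add: cyclic_words_def permutations_of_set_def)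
  qed
  also have "card \<dots> = card {v \<in> permutations_of_set (A - {M}). \<bar>height (M # v) (Suc (length v))\<bar> = 1}"
    by (intro card_image) auto
  also have "\<dots> = EC ((card A - 1) div 2)"
  \<comment> \<open>Here the remaining word is empty and the closing step of \<open>[M]\<close>
    counts as up, which matches the convention \<open>EC 0 = 1\<close>.\<close>
  proof (cases "card A = 1")
    case True
    then have "A - {M} = {}" using M(1) by (metis Diff_cancel card_1_singletonE singletonD)
    then have "{v \<in> permutations_of_set (A - {M}). \<bar>height (M # v) (Suc (length v))\<bar> = 1} = {[]}"
      unfolding \<open>A - {M} = {}\<close> by (auto simp: height_Suc)
    then show ?thesis using True by (simp add: EC_def)
  next
    case False
    define n where "n = (card A - 1) div 2"
    have card: "card (A - {M}) = 2 * n" "n \<ge> 1"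
      using False assms M(1) by (auto simp: n_def elim!: oddE)
    have "height (M # v) (Suc (length v)) = height v (2 * n - 1)"
      if "v \<in> permutations_of_set (A - {M})" for v
    proof -
      have v: "set v = A - {M}" "distinct v" using permutations_of_setD[OF that] by auto
      then have len: "length v = 2 * n" using card distinct_card[of v] by metis
      then have "v \<noteq> []" using card(2) by (metis length_0_conv mult_is_0 not_one_le_zero zero_neq_numeral)
      then have "height (M # v) (Suc (length v)) = height v (length v - 1)"
        by (rule height_Cons_greater) (use v(1) M(2) in blast)
      then show ?thesis by (simp only: len)
    qed
    then have "{v \<in> permutations_of_set (A - {M}). \<bar>height (M # v) (Suc (length v))\<bar> = 1} =
      {v \<in> permutations_of_set (A - {M}). \<bar>height v (2 * n - 1)\<bar> = 1}" by auto
    then show ?thesis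
      using card_words_abs_height_1[OF _ card] assms(1) by (simp add: n_def)
  qed
  finally show ?thesis .
qed

section \<open>Ballot permutations\<close>

definition odd_subsets :: "'a set \<Rightarrow> 'a set set" where
  "odd_subsets S = {A. A \<subseteq> S \<and> odd (card A)}"

lemma finite_odd_subsets [simp]: "finite S \<Longrightarrow> finite (odd_subsets S)"
  by (rule finite_subset[of _ "Pow S"]) (auto simp: odd_subsets_def)

lemma odd_card_complement:
  assumes "finite S" "even (card S)" "A \<subseteq> S"
  shows "odd (card (S - A)) \<longleftrightarrow> odd (card A)"
  using assms card_mono[OF assms(1,3)] by (simp add: card_Diff_subset finite_subset)

lemma complement_odd_subsets:
  assumes "finite S" "even (card S)" "A \<in> odd_subsets S"
  shows "S - A \<in> odd_subsets S"
  using assms odd_card_complement[of S A] by (auto simp: odd_subsets_def)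

text \<open>Grouping by size produces the binomial coefficients of the theorem; as
  \<open>card S\<close> is even, odd subsets are proper, whence the bound
  \<open>card S - 1\<close>.\<close>

lemma sum_odd_subsets:
  fixes f :: "nat \<Rightarrow> nat"
  assumes "finite S" "even (card S)"
  shows "(\<Sum>A\<in>odd_subsets S. f (card A)) =
    (\<Sum>k\<in>{k. odd k \<and> 1 \<le> k \<and> k \<le> card S - 1}. (card S choose k) * f k)"
proof -
  let ?K = "{k. odd k \<and> 1 \<le> k \<and> k \<le> card S - 1}"
  have "card A \<in> ?K" if "A \<in> odd_subsets S" for A
  proof -
    have "odd (card A)" "card A \<le> card S" using that assms by (auto simp: odd_subsets_def card_mono)
    moreover from this have "card A \<noteq> card S" "1 \<le> card A" using assms(2) by (auto simp: odd_pos Suc_leI)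
    ultimately show ?thesis by auto
  qed
  then have "(\<Sum>A\<in>odd_subsets S. f (card A)) =
    (\<Sum>k\<in>?K. \<Sum>A\<in>{A \<in> odd_subsets S. card A = k}. f (card A))"
    using assms(1) by (intro sum.group[symmetric]) auto
  also have "\<dots> = (\<Sum>k\<in>?K. (card S choose k) * f k)"
  proof (rule sum.cong[OF refl])
    fix k assume "k \<in> ?K"
    then have "{A \<in> odd_subsets S. card A = k} = {A. A \<subseteq> S \<and> card A = k}"
      by (auto simp: odd_subsets_def)
    moreover have "(\<Sum>A\<in>{A \<in> odd_subsets S. card A = k}. f (card A)) =
      card {A \<in> odd_subsets S. card A = k} * f k" by simp
    ultimately show "(\<Sum>A\<in>{A \<in> odd_subsets S. card A = k}. f (card A)) = (card S choose k) * f k"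
      by (simp add: n_subsets[OF assms(1)])
  qed
  finally show ?thesis .
qed

text \<open>On \<open>2 * n\<close> letters, with \<open>n \<ge> 1\<close>, final height 1 encodes
  \<open>n - 1\<close> descents.\<close>

definition ballot_words :: "nat set \<Rightarrow> nat list set" where
  "ballot_words A = {w \<in> permutations_of_set A.
     (\<forall>t<length w. 0 \<le> height w t) \<and> height w (length w - 1) = 1}"

section \<open>Splitting ballot words at the last zero\<close>

lemma dyck_words_rev: "w \<in> dyck_words A \<Longrightarrow> rev w \<in> dyck_words A"
  by (auto simp: dyck_words_def permutations_of_set_def dyck_rev)

lemma dyck_wordsD:
  assumes "w \<in> dyck_words A"
  shows "set w = A" "distinct w" "dyck w" "w \<noteq> []"
  using assms by (auto simp: dyck_words_def dyck_def permutations_of_set_def)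

text \<open>The word \<open>u\<close> ends at height 0, and the joining up step lifts the path of
  \<open>v\<close> by one. Hence the end of \<open>u\<close> is the last zero, which is what
  uniqueness of the splitting needs.\<close>

lemma last_passage_append:
  assumes "dyck u" "dyck v" "last u < hd v"
  shows "\<forall>t<length (u @ v). 0 \<le> height (u @ v) t \<and> (length u \<le> t \<longrightarrow> 1 \<le> height (u @ v) t)"
    and "height (u @ v) (length u - 1) = 0" and "height (u @ v) (length (u @ v) - 1) = 1"
proof -
  have uv: "u \<noteq> []" "v \<noteq> []" "height u (length u - 1) = 0" "height v (length v - 1) = 0"
    using assms by (auto simp: dyck_def)
  have R: "height (u @ v) (length u + t) = 1 + height v t" if "t < length v" for t
    using height_append_right[OF uv(1) that] uv(3) assms(3) by (simp add: step_def)
  have ge: "1 \<le> height (u @ v) t" if "length u \<le> t" "t < length (u @ v)" for t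
    using R[of "t - length u"] that assms(2) by (auto simp: dyck_def)
  have "0 \<le> height (u @ v) t" if "t < length (u @ v)" for t
    using ge[of t] that assms(1) by (cases "t < length u") (auto simp: dyck_def height_append_left)
  with ge show "\<forall>t<length (u @ v). 0 \<le> height (u @ v) t \<and> (length u \<le> t \<longrightarrow> 1 \<le> height (u @ v) t)"
    by blast
  show "height (u @ v) (length u - 1) = 0" using uv by (simp add: height_append_left)
  show "height (u @ v) (length (u @ v) - 1) = 1" 
  proof -
    have "length (u @ v) - 1 = length u + (length v - 1)" using uv by (cases v) auto
    then show ?thesis using R[of "length v - 1"] uv by simp
  qed
qed

lemma last_passage_split:
  assumes "distinct w" "w \<noteq> []" "\<forall>t<length w. 0 \<le> height w t" "height w (length w - 1) = 1"
  obtains u v where "w = u @ v" "dyck u" "dyck v" "last u < hd v"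
proof -
  \<comment> \<open>The last zero of the path; index 0 shows that one exists.\<close>
  define p where "p = Max {t. t < length w \<and> height w t = 0}"
  have "p \<in> {t. t < length w \<and> height w t = 0}"
    unfolding p_def using assms(2) by (intro Max_in) (auto intro: exI[of _ 0])
  then have p: "p < length w" "height w p = 0" by auto
  have pos: "1 \<le> height w s" if "p < s" "s < length w" for s
  proof -
    have "height w s \<noteq> 0"
    proof
      assume "height w s = 0"
      then have "s \<le> p" unfolding p_def using that by (intro Max_ge) auto
      with that show False by simp
    qed
    moreover have "0 \<le> height w s" using assms(3) that by blast
    ultimately show ?thesis by linarith
  qed
  have "p \<noteq> length w - 1" using p assms(4) by auto
  then have p': "Suc p < length w" using p by linarith
  define u v where "u = take (Suc p) w" and "v = drop (Suc p) w"
  have w: "w = u @ v" and len: "length u = Suc p" "length v = length w - Suc p"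
    using p' by (auto simp: u_def v_def)
  have ne: "u \<noteq> []" "v \<noteq> []" using len p' by auto
  have L: "height u t = height w t" if "t \<le> p" for t
    using that len height_append_left[of t u v] by (simp add: w)
  have "dyck u" unfolding dyck_def using ne len L p assms(3) by auto
  have R0: "height w (Suc p + t) = step (last u) (hd v) + height v t" if "t < length v" for t
    using height_append_right[OF ne(1) that] L[of p] p(2) len by (simp flip: w)
  \<comment> \<open>The first height after the last zero is positive, so the joining step goes up.
    As \<open>step\<close> is also up on equal letters, distinctness is used to get a strict
    inequality.\<close>
  have "1 \<le> step (last u) (hd v)" using R0[of 0] pos[of "Suc p"] p' ne by simp
  then have "last u \<le> hd v" by (simp add: step_def split: if_splits)
  moreover have "last u \<noteq> hd v"
    using assms(1) ne unfolding w by (metis IntI distinct_append empty_iff hd_in_set last_in_set)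
  ultimately have lt: "last u < hd v" by simp
  then have R: "height v t = height w (Suc p + t) - 1" if "t < length v" for t
    using R0[OF that] by (simp add: step_def)
  have "0 \<le> height v t" if "t < length v" for t
  proof -
    have "Suc p + t < length w" using that len by simp
    then show ?thesis using R[OF that] pos[of "Suc p + t"] by simp
  qed
  moreover have "height v (length v - 1) = 0"
  proof -
    have "Suc p + (length v - 1) = length w - 1" using len p' by simp
    then show ?thesis using R[of "length v - 1"] ne assms(4) by simp
  qed
  ultimately have "dyck v" using ne by (simp add: dyck_def)
  then show thesis using that w \<open>dyck u\<close> lt by blast
qed

text \<open>If \<open>u\<close> were shorter than \<open>u'\<close>, the end of \<open>u'\<close>,
  which is a zero, would lie beyond \<open>u\<close>, where heights are at least 1.\<close>

lemma last_passage_unique: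
  assumes "dyck u" "dyck v" "last u < hd v" "dyck u'" "dyck v'" "last u' < hd v'" "u @ v = u' @ v'"
  shows "u = u' \<and> v = v'"
proof -
  have False if "dyck u" "dyck v" "last u < hd v" "dyck u'" "dyck v'" "last u' < hd v'"
    "u @ v = u' @ v'" "length u < length u'" for u v u' v' :: "nat list"
  proof -
    have "length u \<le> length u' - 1" "length u' - 1 < length (u' @ v')" using that(8) by auto
    then have "1 \<le> height (u' @ v') (length u' - 1)"
      using last_passage_append(1)[OF that(1-3)] that(7) by metis
    then show False using last_passage_append(2)[OF that(4-6)] by simp
  qed
  from this[of u v u' v'] this[of u' v' u v] assms have "length u = length u'" by force
  then show ?thesis using assms(7) by simp
qed

text \<open>The triples in \<open>X\<close> split into \<open>L\<close>, joined by an ascent, and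
  \<open>G\<close>, joined by a descent. Concatenation maps \<open>L\<close> bijectively to the
  ballot words, and an involution shows that \<open>L\<close> is half of \<open>X\<close>.\<close>

lemma card_ballot_words:
  assumes "finite S" "S \<noteq> {}" "even (card S)"
  shows "2 * card (ballot_words S) =
    (\<Sum>A\<in>odd_subsets S. card (dyck_words A) * card (dyck_words (S - A)))"
proof -
  define X where "X = Sigma (odd_subsets S) (\<lambda>A. dyck_words A \<times> dyck_words (S - A))"
  define L where "L = {x \<in> X. last (fst (snd x)) < hd (snd (snd x))}"
  define G where "G = {x \<in> X. last (fst (snd x)) > hd (snd (snd x))}"
  have fin: "finite X" unfolding X_def using assms(1)
    by (intro finite_SigmaI) (auto simp: dyck_words_def)
  have ends: "last u \<in> A" "hd v \<in> S - A" if "(A, u, v) \<in> X" for A u v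
  proof -
    have uv: "u \<in> dyck_words A" "v \<in> dyck_words (S - A)" using that by (auto simp: X_def)
    show "last u \<in> A" using dyck_wordsD[OF uv(1)] last_in_set by metis
    show "hd v \<in> S - A" using dyck_wordsD[OF uv(2)] hd_in_set by metis
  qed
  \<comment> \<open>Ties cannot occur, because the two letters lie in complementary sets.\<close>
  have X_eq: "X = L \<union> G"
  proof -
    have "last (fst (snd x)) \<noteq> hd (snd (snd x))" if "x \<in> X" for x
      using ends[of "fst x" "fst (snd x)" "snd (snd x)"] that by auto
    then show ?thesis unfolding L_def G_def by (auto simp: linorder_neq_iff)
  qed
  \<comment> \<open>After the exchange the joining letters are \<open>hd v\<close> and
    \<open>last u\<close>, the old pair in opposite order.\<close>
  have "bij_betw (\<lambda>(A, u, v). (S - A, rev v, rev u)) L G"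
  proof (rule bij_betw_byWitness[where f' = "\<lambda>(A, u, v). (S - A, rev v, rev u)"])
    have sub: "S - (S - A) = A" if "(A, u, v) \<in> X" for A u v
      using that by (auto simp: X_def odd_subsets_def)
    have mem: "(S - A, rev v, rev u) \<in> X" if "(A, u, v) \<in> X" for A u v
      using that complement_odd_subsets[OF assms(1,3), of A] sub[OF that] dyck_words_rev
      by (auto simp: X_def)
    have ne: "u \<noteq> []" "v \<noteq> []" if "(A, u, v) \<in> X" for A u v
      using that dyck_wordsD(4) by (auto simp: X_def)
    show "\<forall>x\<in>L. (\<lambda>(A, u, v). (S - A, rev v, rev u)) ((\<lambda>(A, u, v). (S - A, rev v, rev u)) x) = x"
      "\<forall>x\<in>G. (\<lambda>(A, u, v). (S - A, rev v, rev u)) ((\<lambda>(A, u, v). (S - A, rev v, rev u)) x) = x"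
      using sub by (auto simp: L_def G_def)
    show "(\<lambda>(A, u, v). (S - A, rev v, rev u)) ` L \<subseteq> G"
      "(\<lambda>(A, u, v). (S - A, rev v, rev u)) ` G \<subseteq> L"
      using mem ne by (auto simp: L_def G_def last_rev hd_rev)
  qed
  then have "card G = card L" by (rule bij_betw_same_card[symmetric])
  moreover have "card X = card L + card G"
  proof -
    have "L \<inter> G = {}" "finite L" "finite G" using fin by (auto simp: L_def G_def)
    then show ?thesis using X_eq card_Un_disjoint by metis
  qed
  moreover have "card X = (\<Sum>A\<in>odd_subsets S. card (dyck_words A) * card (dyck_words (S - A)))"
    unfolding X_def using assms(1)
    by (subst card_SigmaI) (auto simp: card_cartesian_product dyck_words_def)
  moreover have "bij_betw (\<lambda>(A, u, v). u @ v) L (ballot_words S)"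
  proof (rule bij_betw_imageI)
    have L_D: "dyck u" "dyck v" "last u < hd v" "set u = A" "set v = S - A" "distinct (u @ v)" "A \<subseteq> S"
      if "(A, u, v) \<in> L" for A u v
    proof -
      have uv: "u \<in> dyck_words A" "v \<in> dyck_words (S - A)" and "A \<subseteq> S" "last u < hd v"
        using that by (auto simp: L_def X_def odd_subsets_def)
      then show "dyck u" "dyck v" "last u < hd v" "set u = A" "set v = S - A" "A \<subseteq> S"
        using dyck_wordsD by blast+
      then show "distinct (u @ v)" using dyck_wordsD(2)[OF uv(1)] dyck_wordsD(2)[OF uv(2)] by auto
    qed
    show "inj_on (\<lambda>(A, u, v). u @ v) L"
    proof (rule inj_onI)
      fix x y assume xy: "x \<in> L" "y \<in> L" "(\<lambda>(A, u, v). u @ v) x = (\<lambda>(A, u, v). u @ v) y"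
      obtain A u v A' u' v' where eq: "x = (A, u, v)" "y = (A', u', v')" by (cases x, cases y) auto
      with xy have *: "(A, u, v) \<in> L" "(A', u', v') \<in> L" "u @ v = u' @ v'" by auto
      have "u = u' \<and> v = v'"
        using last_passage_unique[OF L_D(1-3)[OF *(1)] L_D(1-3)[OF *(2)] *(3)] .
      then show "x = y" using L_D(4)[OF *(1)] L_D(4)[OF *(2)] eq by simp
    qed
    show "(\<lambda>(A, u, v). u @ v) ` L = ballot_words S"
    proof (intro equalityI subsetI)
      fix w assume "w \<in> (\<lambda>(A, u, v). u @ v) ` L"
      then obtain A u v where L: "(A, u, v) \<in> L" and w: "w = u @ v" by auto
      have "set w = S" using L_D(4,5,7)[OF L] w by auto
      then show "w \<in> ballot_words S"
        using last_passage_append[OF L_D(1-3)[OF L]] L_D(6)[OF L]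
        by (simp add: ballot_words_def permutations_of_set_def w)
    next
      fix w assume "w \<in> ballot_words S"
      then have w: "distinct w" "set w = S" "\<forall>t<length w. 0 \<le> height w t" "height w (length w - 1) = 1"
        by (auto simp: ballot_words_def permutations_of_set_def)
      then have "w \<noteq> []" using assms(2) by auto
      with w obtain u v where uv: "w = u @ v" "dyck u" "dyck v" "last u < hd v"
        using last_passage_split[of w] by metis
      then have "set v = S - set u" "distinct u" "distinct v" "set u \<subseteq> S" using w(1,2) by auto
      \<comment> \<open>Heights alternate in parity, so a path returning to 0 has an odd number of
        letters.\<close>
      moreover have "odd (card (set u))"
        using odd_length_dyck[OF uv(2)] \<open>distinct u\<close> by (simp add: distinct_card)
      ultimately have "(set u, u, v) \<in> L"
        using uv by (simp add: L_def X_def dyck_words_def permutations_of_set_def odd_subsets_def)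
      then show "w \<in> (\<lambda>(A, u, v). u @ v) ` L" using uv(1) by force
    qed
  qed
  then have "card L = card (ballot_words S)" by (rule bij_betw_same_card)
  ultimately show ?thesis by simp
qed

lemma ballot_num_eq_card_ballot_words:
  assumes "n \<ge> 1"
  shows "ballot_num (2 * n) (n - 1) = card (ballot_words {1..2 * n})"
proof -
  let ?W = "\<lambda>\<pi> :: nat \<Rightarrow> nat. map \<pi> [1..<Suc (2 * n)]"
  have iff: "(\<forall>t<length (?W \<pi>). 0 \<le> height (?W \<pi>) t) \<and> height (?W \<pi>) (length (?W \<pi>) - 1) = 1 \<longleftrightarrow>
    ballot (2 * n) \<pi> \<and> des (2 * n) \<pi> = n - 1" if \<pi>: "\<pi> permutes {1..2 * n}" for \<pi>
  proof -
    have len: "length (?W \<pi>) = 2 * n" by (simp del: upt_Suc)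
    have nonneg: "0 \<le> height (?W \<pi>) t \<longleftrightarrow> descents_upto \<pi> t \<le> ascents_upto \<pi> t" if "t < 2 * n" for t
      using ascents_descents_height[OF \<pi> that] by linarith
    have "t \<in> {1..2 * n - 1} \<longleftrightarrow> t < 2 * n \<and> t \<noteq> 0" for t using assms by auto
    then have "ballot (2 * n) \<pi> \<longleftrightarrow> (\<forall>t<2 * n. t \<noteq> 0 \<longrightarrow> 0 \<le> height (?W \<pi>) t)"
      unfolding ballot_def using nonneg by blast
    \<comment> \<open>Prefixes in \<open>ballot\<close> start at length 1; at \<open>t = 0\<close>
      the height is 0.\<close>
    also have "\<dots> \<longleftrightarrow> (\<forall>t<2 * n. 0 \<le> height (?W \<pi>) t)"
      by (metis height_0 order_refl)
    finally show ?thesis unfolding len using des_eq_iff_height[OF \<pi> assms] by blast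
  qed
  have "bij_betw ?W {\<pi> \<in> {\<pi>. \<pi> permutes {1..2 * n}}. ballot (2 * n) \<pi> \<and> des (2 * n) \<pi> = n - 1}
    (ballot_words {1..2 * n})"
    unfolding ballot_words_def
    by (rule bij_betw_Collect[OF word_of_perm_bij]) (use iff in blast)
  then show ?thesis unfolding ballot_num_def by (simp add: bij_betw_same_card)
qed

section \<open>Permutations with odd cycles\<close>

lemma sum_step_eq_cA_cD:
  assumes "finite C"
  shows "(\<Sum>c\<in>C. step c (\<pi> c)) = int (cA \<pi> C) - int (cD \<pi> C)" and "cA \<pi> C + cD \<pi> C = card C"
proof -
  have eq: "C = {c \<in> C. c \<le> \<pi> c} \<union> {c \<in> C. c > \<pi> c}" by auto
  have "(\<Sum>c\<in>C. step c (\<pi> c)) =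
    (\<Sum>c\<in>{c \<in> C. c \<le> \<pi> c}. step c (\<pi> c)) + (\<Sum>c\<in>{c \<in> C. c > \<pi> c}. step c (\<pi> c))"
    by (subst eq, rule sum.union_disjoint) (use assms in auto)
  also have "(\<Sum>c\<in>{c \<in> C. c \<le> \<pi> c}. step c (\<pi> c)) = (\<Sum>c\<in>{c \<in> C. c \<le> \<pi> c}. 1)"
    by (rule sum.cong) (auto simp: step_def)
  also have "(\<Sum>c\<in>{c \<in> C. c > \<pi> c}. step c (\<pi> c)) = (\<Sum>c\<in>{c \<in> C. c > \<pi> c}. - 1)"
    by (rule sum.cong) (auto simp: step_def)
  finally show "(\<Sum>c\<in>C. step c (\<pi> c)) = int (cA \<pi> C) - int (cD \<pi> C)"
    by (simp add: cA_def cD_def)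
  show "cA \<pi> C + cD \<pi> C = card C"
    unfolding cA_def cD_def by (subst (3) eq, rule card_Un_disjoint[symmetric]) (use assms in auto)
qed

text \<open>The counts \<open>cA\<close> and \<open>cD\<close> have an odd sum, so they differ by at
  least one; \<open>M_cycle\<close> is maximal when they differ by exactly one.\<close>

lemma M_cycle_odd:
  assumes "odd (card C)"
  shows "2 * M_cycle \<pi> C + 1 \<le> card C"
    and "2 * M_cycle \<pi> C + 1 = card C \<longleftrightarrow> \<bar>\<Sum>c\<in>C. step c (\<pi> c)\<bar> = 1"
proof -
  have "finite C" using assms card.infinite by fastforce
  note * = sum_step_eq_cA_cD[OF this, of \<pi>]
  obtain m where m: "card C = 2 * m + 1" using assms by (elim oddE)
  show "2 * M_cycle \<pi> C + 1 \<le> card C" using *(2) m by (simp add: M_cycle_def min_def)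
  show "2 * M_cycle \<pi> C + 1 = card C \<longleftrightarrow> \<bar>\<Sum>c\<in>C. step c (\<pi> c)\<bar> = 1"
    unfolding *(1) M_cycle_def min_def using *(2) m by (auto split: if_splits)
qed

lemma cycles_of_partition:
  assumes "\<pi> permutes {1..m}"
  shows "\<Union>(cycles_of m \<pi>) = {1..m}" "C \<in> cycles_of m \<pi> \<Longrightarrow> cyclic_on \<pi> C"
    "finite (cycles_of m \<pi>)" "pairwise disjnt (cycles_of m \<pi>)"
proof -
  have self: "x \<in> orbit \<pi> x" for x
    using assms by (intro permutation_self_in_orbit) (auto simp: permutation_permutes)
  show "\<Union>(cycles_of m \<pi>) = {1..m}"
    using self permutes_orbit_subset[OF assms] unfolding cycles_of_def by blast
  have cyc: "cyclic_on \<pi> C" if "C \<in> cycles_of m \<pi>" for C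
    using that cyclic_on_orbit[OF assms] by (auto simp: cycles_of_def)
  then show "C \<in> cycles_of m \<pi> \<Longrightarrow> cyclic_on \<pi> C" .
  show "finite (cycles_of m \<pi>)" by (simp add: cycles_of_def)
  show "pairwise disjnt (cycles_of m \<pi>)"
  proof (rule pairwiseI, unfold disjnt_def, rule ccontr)
    fix C D assume "C \<in> cycles_of m \<pi>" "D \<in> cycles_of m \<pi>" "C \<noteq> D" "C \<inter> D \<noteq> {}"
    then show False using orbit_cyclic_eq3[OF cyc] by blast
  qed
qed

section \<open>Permutations with two prescribed cycles\<close>

definition two_cycle_perms :: "nat set \<Rightarrow> nat set \<Rightarrow> (nat \<Rightarrow> nat) set" where
  "two_cycle_perms A B = {\<pi>. \<pi> permutes A \<union> B \<and> cyclic_on \<pi> A \<and> cyclic_on \<pi> B \<and>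
     \<bar>\<Sum>c\<in>A. step c (\<pi> c)\<bar> = 1 \<and> \<bar>\<Sum>c\<in>B. step c (\<pi> c)\<bar> = 1}"

text \<open>On disjoint supports, composing the two cycles and restricting to \<open>A\<close> and
  \<open>B\<close> are mutually inverse.\<close>

lemma card_two_cycle_perms:
  assumes "A \<inter> B = {}"
  shows "card (two_cycle_perms A B) = card (cyclic_perms A) * card (cyclic_perms B)"
proof -
  have "bij_betw (\<lambda>(\<rho>, \<sigma>). \<rho> \<circ> \<sigma>) (cyclic_perms A \<times> cyclic_perms B) (two_cycle_perms A B)"
  proof (rule bij_betw_byWitness[where f' = "\<lambda>\<pi>. (perm_restrict \<pi> A, perm_restrict \<pi> B)"])
    have onA: "(\<rho> \<circ> \<sigma>) x = \<rho> x" if "\<sigma> permutes B" "x \<in> A" for \<rho> \<sigma> :: "nat \<Rightarrow> nat" and x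
    proof -
      have "x \<notin> B" using that assms by blast
      then show ?thesis using permutes_not_in[OF that(1)] by simp
    qed
    have onB: "(\<rho> \<circ> \<sigma>) x = \<sigma> x" if "\<rho> permutes A" "\<sigma> permutes B" "x \<in> B" for \<rho> \<sigma> x
    proof -
      have "\<sigma> x \<in> B" using that by (simp add: permutes_in_image)
      then have "\<sigma> x \<notin> A" using assms by blast
      then show ?thesis using permutes_not_in[OF that(1)] by simp
    qed
    show "\<forall>x\<in>cyclic_perms A \<times> cyclic_perms B.
      (\<lambda>\<pi>. (perm_restrict \<pi> A, perm_restrict \<pi> B)) ((\<lambda>(\<rho>, \<sigma>). \<rho> \<circ> \<sigma>) x) = x"
    proof
      fix x assume "x \<in> cyclic_perms A \<times> cyclic_perms B"
      then obtain \<rho> \<sigma> where x: "x = (\<rho>, \<sigma>)" and p: "\<rho> permutes A" "\<sigma> permutes B"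
        by (auto simp: cyclic_perms_def)
      have "perm_restrict (\<rho> \<circ> \<sigma>) A = \<rho>"
        using onA[OF p(2)] permutes_not_in[OF p(1)] by (auto simp: fun_eq_iff perm_restrict_def)
      moreover have "perm_restrict (\<rho> \<circ> \<sigma>) B = \<sigma>"
        using onB[OF p] permutes_not_in[OF p(2)] by (auto simp: fun_eq_iff perm_restrict_def)
      ultimately show "(\<lambda>\<pi>. (perm_restrict \<pi> A, perm_restrict \<pi> B)) ((\<lambda>(\<rho>, \<sigma>). \<rho> \<circ> \<sigma>) x) = x"
        by (simp add: x)
    qed
    show "\<forall>\<pi>\<in>two_cycle_perms A B.
      (\<lambda>(\<rho>, \<sigma>). \<rho> \<circ> \<sigma>) (perm_restrict \<pi> A, perm_restrict \<pi> B) = \<pi>"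
      using assms by (auto simp: two_cycle_perms_def perm_restrict_comp)
    show "(\<lambda>(\<rho>, \<sigma>). \<rho> \<circ> \<sigma>) ` (cyclic_perms A \<times> cyclic_perms B) \<subseteq> two_cycle_perms A B"
    proof clarify
      fix \<rho> \<sigma> assume *: "\<rho> \<in> cyclic_perms A" "\<sigma> \<in> cyclic_perms B"
      then have p: "\<rho> permutes A" "\<sigma> permutes B" by (auto simp: cyclic_perms_def)
      have "\<rho> \<circ> \<sigma> permutes A \<union> B"
        using p by (intro permutes_compose permutes_subset[OF p(1)] permutes_subset[OF p(2)]) auto
      moreover have "cyclic_on (\<rho> \<circ> \<sigma>) A \<longleftrightarrow> cyclic_on \<rho> A" using onA[OF p(2)] by (rule cyclic_cong)
      moreover have "cyclic_on (\<rho> \<circ> \<sigma>) B \<longleftrightarrow> cyclic_on \<sigma> B" using onB[OF p] by (rule cyclic_cong)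
      moreover have "(\<Sum>c\<in>A. step c ((\<rho> \<circ> \<sigma>) c)) = (\<Sum>c\<in>A. step c (\<rho> c))"
        by (rule sum.cong[OF refl]) (simp only: onA[OF p(2)])
      moreover have "(\<Sum>c\<in>B. step c ((\<rho> \<circ> \<sigma>) c)) = (\<Sum>c\<in>B. step c (\<sigma> c))"
        by (rule sum.cong[OF refl]) (simp only: onB[OF p])
      ultimately show "\<rho> \<circ> \<sigma> \<in> two_cycle_perms A B"
        using * unfolding two_cycle_perms_def cyclic_perms_def by simp
    qed
    show "(\<lambda>\<pi>. (perm_restrict \<pi> A, perm_restrict \<pi> B)) ` two_cycle_perms A B
      \<subseteq> cyclic_perms A \<times> cyclic_perms B"
    proof (rule image_subsetI)
      fix \<pi> assume \<pi>: "\<pi> \<in> two_cycle_perms A B"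
      \<comment> \<open>\<open>perm_restrict_diff_cyclic\<close> removes a cycle from the support,
        so restricting to \<open>A\<close> is seen as removing \<open>B\<close>, and vice
        versa.\<close>
      have "A \<union> B - B = A" "A \<union> B - A = B" using assms by auto
      then have "perm_restrict \<pi> A permutes A" "perm_restrict \<pi> B permutes B"
        using perm_restrict_diff_cyclic[of \<pi> "A \<union> B" A] perm_restrict_diff_cyclic[of \<pi> "A \<union> B" B] \<pi>
        by (auto simp: two_cycle_perms_def)
      moreover have "(\<Sum>c\<in>C. step c (perm_restrict \<pi> C c)) = (\<Sum>c\<in>C. step c (\<pi> c))" for C
        by (intro sum.cong) (auto simp: perm_restrict_def)
      ultimately show "(perm_restrict \<pi> A, perm_restrict \<pi> B) \<in> cyclic_perms A \<times> cyclic_perms B"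
        using \<pi> by (simp add: cyclic_perms_def two_cycle_perms_def cyclic_on_perm_restrict)
    qed
  qed
  from bij_betw_same_card[OF this] show ?thesis by (simp add: card_cartesian_product)
qed

lemma cycles_of_two_cycle_perm:
  assumes "\<pi> \<in> two_cycle_perms A B" "A \<union> B = {1..m}"
  shows "cycles_of m \<pi> = {A, B}"
proof -
  have cyc: "cyclic_on \<pi> A" "cyclic_on \<pi> B" using assms(1) by (auto simp: two_cycle_perms_def)
  then have "A \<noteq> {}" "B \<noteq> {}" by (auto simp: cyclic_on_alldef)
  moreover have "orbit \<pi> x = A" if "x \<in> A" for x using cyc that by (simp add: orbit_cyclic_eq3)
  moreover have "orbit \<pi> x = B" if "x \<in> B" for x using cyc that by (simp add: orbit_cyclic_eq3)
  ultimately show ?thesis unfolding cycles_of_def assms(2)[symmetric] by (auto simp: image_iff)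
qed

text \<open>The value \<open>n - 1\<close> is so large that the bound of \<open>M_cycle_odd\<close>,
  summed over the cycles, admits only two cycles and must be attained on both.\<close>

lemma odd_cycle_perm_iff:
  assumes "A \<in> odd_subsets {1..2 * n}" "n \<ge> 1"
  shows "\<pi> permutes {1..2 * n} \<and> (\<forall>C\<in>cycles_of (2 * n) \<pi>. odd (card C)) \<and> M_perm (2 * n) \<pi> = n - 1 \<and>
    A \<in> cycles_of (2 * n) \<pi> \<longleftrightarrow> \<pi> \<in> two_cycle_perms A ({1..2 * n} - A)" (is "?L \<longleftrightarrow> ?R")
proof -
  define S where "S = {1..2 * n}"
  define B where "B = S - A"
  have A: "A \<subseteq> S" "odd (card A)" using assms(1) by (auto simp: odd_subsets_def S_def)
  have AB: "A \<union> B = S" "A \<inter> B = {}" "odd (card B)"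
    using A odd_card_complement[of S A] by (auto simp: B_def S_def)
  have neq: "A \<noteq> B" using AB(2) A(2) by (metis card.empty even_zero inf.idem)
  have "finite A" "finite B" using A by (auto simp: B_def S_def intro: finite_subset)
  then have cards: "card A + card B = 2 * n"
    using card_Un_disjoint[of A B] AB by (simp add: S_def)
  show ?thesis
  proof
    assume ?R
    then have R: "\<pi> \<in> two_cycle_perms A B" by (simp add: B_def S_def)
    then have cyc: "cycles_of (2 * n) \<pi> = {A, B}"
      using AB(1) by (intro cycles_of_two_cycle_perm) (auto simp: S_def)
    have "2 * M_cycle \<pi> A + 1 = card A" "2 * M_cycle \<pi> B + 1 = card B"
      using R A(2) AB(3) M_cycle_odd(2) by (auto simp: two_cycle_perms_def)
    then have "M_perm (2 * n) \<pi> = n - 1"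
      unfolding M_perm_def cyc using neq cards by simp
    then show ?L using cyc A(2) AB neq R by (auto simp: two_cycle_perms_def S_def)
  next
    assume L: ?L
    let ?C = "cycles_of (2 * n) \<pi>"
    have \<pi>: "\<pi> permutes {1..2 * n}" using L by simp
    note part = cycles_of_partition[OF \<pi>]
    have odd: "odd (card C)" if "C \<in> ?C" for C using L that by blast
    have fin: "finite C" if "C \<in> ?C" for C using finite_cyclic_on[OF part(2)[OF that]] .
    have total: "(\<Sum>C\<in>?C. card C) = 2 * n"
      using card_Union_disjoint[OF part(4) fin] part(1) by simp
    have M: "(\<Sum>C\<in>?C. M_cycle \<pi> C) = n - 1" using L by (simp add: M_perm_def)
    \<comment> \<open>The total size \<open>2 * n\<close> leaves room for at most two
      cycles.\<close>
    have "2 * (n - 1) + card ?C = (\<Sum>C\<in>?C. 2 * M_cycle \<pi> C + 1)"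
      unfolding sum.distrib sum_distrib_left[symmetric] M by simp
    also have "\<dots> \<le> (\<Sum>C\<in>?C. card C)" using odd M_cycle_odd(1) by (intro sum_mono) blast
    finally have le: "card ?C \<le> 2" using total assms(2) by simp
    \<comment> \<open>Odd sizes with an even sum are even in number; as \<open>A\<close> is a cycle,
      exactly two remain.\<close>
    have "even (card ?C)"
    proof -
      have "even (\<Sum>C\<in>?C. card C)" using total by simp
      moreover have "{C \<in> ?C. odd (card C)} = ?C" using odd by auto
      ultimately show ?thesis using part(3) by (simp add: even_sum_iff)
    qed
    moreover have "card ?C \<noteq> 0" using L part(3) by auto
    ultimately have "card ?C = 2" using le by (cases "card ?C = 1") auto
    then obtain D where D: "?C = {A, D}" "D \<noteq> A" using L unfolding card_2_iff by fastforce
    have "A \<inter> D = {}" using part(4) D by (auto simp: pairwise_def disjnt_def)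
    moreover have "A \<union> D = S" using part(1) D by (simp add: S_def)
    ultimately have "D = B" by (auto simp: B_def)
    with D have C: "?C = {A, B}" by simp
    then have "M_cycle \<pi> A + M_cycle \<pi> B = n - 1"
      using L neq by (simp add: M_perm_def)
    \<comment> \<open>The left sides and the right sides both add up to \<open>2 * n\<close>, so
      neither inequality can be strict.\<close>
    then have "2 * M_cycle \<pi> A + 1 = card A" "2 * M_cycle \<pi> B + 1 = card B"
      using M_cycle_odd(1)[OF A(2), of \<pi>] M_cycle_odd(1)[OF AB(3), of \<pi>] cards assms(2) by linarith+
    then have "\<bar>\<Sum>c\<in>A. step c (\<pi> c)\<bar> = 1" "\<bar>\<Sum>c\<in>B. step c (\<pi> c)\<bar> = 1"
      using M_cycle_odd(2) A(2) AB(3) by blast+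
    then have "\<pi> \<in> two_cycle_perms A B"
      using \<pi> part(2) C AB(1) by (simp add: two_cycle_perms_def S_def)
    then show ?R by (simp add: B_def S_def)
  qed
qed

text \<open>Double counting of pairs of a permutation and one of its cycles \<open>A\<close>: each
  permutation in \<open>P\<close> has two cycles, and fixing \<open>A\<close> fixes the other one as
  its complement.\<close>

lemma card_odd_cycle_perms:
  assumes "n \<ge> 1"
  shows "2 * oddcyc_num (2 * n) (n - 1) = (\<Sum>A\<in>odd_subsets {1..2 * n}.
    card (cyclic_perms A) * card (cyclic_perms ({1..2 * n} - A)))"
proof -
  let ?S = "{1..2 * n}"
  define P where "P = {\<pi>. \<pi> permutes ?S \<and> (\<forall>C\<in>cycles_of (2 * n) \<pi>. odd (card C)) \<and>
    M_perm (2 * n) \<pi> = n - 1}"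
  have "finite P" unfolding P_def by (rule finite_subset[OF _ finite_permutations[of ?S]]) auto
  have iff: "\<pi> \<in> P \<and> A \<in> cycles_of (2 * n) \<pi> \<longleftrightarrow> \<pi> \<in> two_cycle_perms A (?S - A)"
    if "A \<in> odd_subsets ?S" for A \<pi>
    using odd_cycle_perm_iff[OF that assms, of \<pi>] unfolding P_def by blast
  have "card {A \<in> odd_subsets ?S. A \<in> cycles_of (2 * n) \<pi>} = 2" if \<pi>: "\<pi> \<in> P" for \<pi>
  proof -
    have perm: "\<pi> permutes ?S" using \<pi> by (simp add: P_def)
    have all: "{A \<in> odd_subsets ?S. A \<in> cycles_of (2 * n) \<pi>} = cycles_of (2 * n) \<pi>"
      using \<pi> cycles_of_partition(1)[OF perm] by (auto simp: odd_subsets_def P_def)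
    have "1 \<in> \<Union>(cycles_of (2 * n) \<pi>)" using cycles_of_partition(1)[OF perm] assms by simp
    then obtain A where A: "A \<in> cycles_of (2 * n) \<pi>" by blast
    then have "A \<in> odd_subsets ?S" using all by blast
    then have sub: "A \<subseteq> ?S" and R: "\<pi> \<in> two_cycle_perms A (?S - A)"
      using iff \<pi> A by (auto simp: odd_subsets_def)
    have "cycles_of (2 * n) \<pi> = {A, ?S - A}"
      by (rule cycles_of_two_cycle_perm[OF R]) (use sub in auto)
    moreover have "A \<noteq> ?S - A"
    proof -
      have "A \<noteq> {}" using R by (auto simp: two_cycle_perms_def cyclic_on_def)
      then show ?thesis by blast
    qed
    ultimately show ?thesis unfolding all by simp
  qed
  then have "(\<Sum>A\<in>odd_subsets ?S. card {\<pi> \<in> P. A \<in> cycles_of (2 * n) \<pi>}) = 2 * card P"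
    using \<open>finite P\<close> by (intro sum_multicount) auto
  moreover have "card {\<pi> \<in> P. A \<in> cycles_of (2 * n) \<pi>} =
    card (cyclic_perms A) * card (cyclic_perms (?S - A))" if "A \<in> odd_subsets ?S" for A
  proof -
    have "{\<pi> \<in> P. A \<in> cycles_of (2 * n) \<pi>} = two_cycle_perms A (?S - A)"
      using iff[OF that] by blast
    then show ?thesis by (simp add: card_two_cycle_perms)
  qed
  ultimately show ?thesis by (simp add: oddcyc_num_def P_def)
qed

theorem theorem1p8:
  fixes n :: nat
  assumes "n \<ge> 1"
  shows "ballot_num (2 * n) (n - 1) = oddcyc_num (2 * n) (n - 1) \<and>
    real (oddcyc_num (2 * n) (n - 1)) =
      1 / 2 * (\<Sum>k \<in> {k. odd k \<and> 1 \<le> k \<and> k \<le> 2 * n - 1}.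
        real ((2 * n) choose k) * real (EC ((k - 1) div 2)) * real (EC ((2 * n - k - 1) div 2)))"
proof -
  let ?S = "{1..2 * n}"
  \<comment> \<open>Pairs of cyclic permutations and pairs of Dyck words on \<open>A\<close> and its
    complement are both counted by \<open>f (card A)\<close>, so twice either number is the same sum
    \<open>T\<close>.\<close>
  define f where "f k = EC ((k - 1) div 2) * EC ((2 * n - k - 1) div 2)" for k
  have S: "finite ?S" "even (card ?S)" "?S \<noteq> {}" using assms by auto
  have cyc: "card (cyclic_perms A) * card (cyclic_perms (?S - A)) = f (card A)"
    and dyck: "card (dyck_words A) * card (dyck_words (?S - A)) = f (card A)"
    if "A \<in> odd_subsets ?S" for A
  proof -
    have A: "A \<subseteq> ?S" "odd (card A)" "finite A"
      using that by (auto simp: odd_subsets_def intro: finite_subset)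
    have B: "odd (card (?S - A))" using odd_card_complement[OF S(1,2) A(1)] A(2) by simp
    have "card (?S - A) = 2 * n - card A" using A by (simp add: card_Diff_subset)
    then show *: "card (cyclic_perms A) * card (cyclic_perms (?S - A)) = f (card A)"
      using card_cyclic_perms_eq_EC[OF A(3,2)] card_cyclic_perms_eq_EC[OF _ B] by (simp add: f_def)
    have "A \<noteq> {}" "?S - A \<noteq> {}" using A(2) B by (metis card.empty even_zero)+
    then show "card (dyck_words A) * card (dyck_words (?S - A)) = f (card A)"
      using * by (simp add: card_dyck_words)
  qed
  define T where "T = (\<Sum>k\<in>{k. odd k \<and> 1 \<le> k \<and> k \<le> 2 * n - 1}. ((2 * n) choose k) * f k)"
  have T: "(\<Sum>A\<in>odd_subsets ?S. f (card A)) = T"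
    using sum_odd_subsets[OF S(1,2), of f] by (simp add: T_def)
  have "2 * oddcyc_num (2 * n) (n - 1) = T"
    unfolding card_odd_cycle_perms[OF assms] T[symmetric] by (rule sum.cong[OF refl cyc])
  moreover have "2 * ballot_num (2 * n) (n - 1) = T"
    unfolding ballot_num_eq_card_ballot_words[OF assms] card_ballot_words[OF S(1,3,2)] T[symmetric]
    by (rule sum.cong[OF refl dyck])
  moreover have "real T = (\<Sum>k \<in> {k. odd k \<and> 1 \<le> k \<and> k \<le> 2 * n - 1}.
    real ((2 * n) choose k) * real (EC ((k - 1) div 2)) * real (EC ((2 * n - k - 1) div 2)))"
    by (simp add: T_def f_def mult.assoc)
  ultimately show ?thesis by auto
qed

end
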